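(* Let $K$ be a field, let $X$ be an infinite set of indeterminates, and let $R = K[X]$ be the polynomial ring in the indeterminates $X$ over $K$. For every positive integer $n$, there are invariant ideals $I \subseteq R$ such that $I$ is generated as an $R[\mathfrak{S}_X]$-module by $n$ polynomials, but $I$ cannot be generated as an $R[\mathfrak{S}_X]$-module by fewer than $n$ elements.
   Context: $\mathfrak{S}_X$ denotes the symmetric group of $X$, i.e. the group of all permutations of the set $X$. It acts on $R = K[X]$ by $K$-algebra automorphisms permuting the indeterminates. $R[\mathfrak{S}_X]$ denotes the (left) group ring of $\mathfrak{S}_X$ over $R$, whose elements are finite formal sums $\sum_\sigma s_\sigma \sigma$ with $s_\sigma \in R$ and $\sigma \in \mathfrak{S}_X$; it acts naturally on $R$ by $\left(\sum_\sigma s_\sigma \sigma\right) f = \sum_\sigma s_\sigma\, \sigma(f)$. An invariant ideal $I \subseteq R$ is an $R[\mathfrak{S}_X]$-submodule of $R$, i.e. an ideal of $R$ with $\sigma(I) \subseteq I$ for all $\sigma \in \mathfrak{S}_X$. Polynomials $p_1, \ldots, p_k \in R$ generate $I$ over $R[\mathfrak{S}_X]$ if $I$ is the smallest $R[\mathfrak{S}_X]$-submodule of $R$ containing $p_1,\ldots,p_k$, i.e. $I$ is the ideal of $R$ generated by all $\sigma(p_l)$ with $\sigma \in \mathfrak{S}_X$, $1 \le l \le k$. *)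

theory Defs
  imports Complex_Main "HOL-Library.Poly_Mapping"
begin

text \<open>
  The polynomial ring \<open>K[X]\<close>: the indeterminates are the elements of the type \<open>'x\<close>, a monomial is its
  finitely supported exponent vector, and a polynomial is a finitely supported family of
  coefficients. Multiplication is the convolution product on \<^type>\<open>poly_mapping\<close>.
\<close>

type_synonym ('x, 'k) mpoly = "('x \<Rightarrow>\<^sub>0 nat) \<Rightarrow>\<^sub>0 'k"

definition Const :: "'k::comm_ring_1 \<Rightarrow> ('x, 'k) mpoly"
  where "Const c = Poly_Mapping.single 0 c"

definition Var :: "'x \<Rightarrow> ('x, 'k::comm_ring_1) mpoly"
  where "Var x = Poly_Mapping.single (Poly_Mapping.single x 1) 1"

text \<open>
  The action of a permutation \<open>\<sigma>\<close> of the indeterminates. The coefficient of \<open>\<sigma>(f)\<close> at a monomial \<open>m\<close>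
  is that of \<open>f\<close> at \<open>\<sigma>\<inverse>(m)\<close>, whose exponent vector is \<open>m \<circ> \<sigma>\<close>; \<^const>\<open>Poly_Mapping.map_key\<close> is
  precomposition. The lemmas \<open>perm_act_add\<close> to \<open>perm_act_Var\<close> show that this is the \<open>K\<close>-algebra
  endomorphism mapping \<open>x\<close> to \<open>\<sigma>(x)\<close>.
\<close>

definition perm_act :: "('x \<Rightarrow> 'x) \<Rightarrow> ('x, 'k::comm_ring_1) mpoly \<Rightarrow> ('x, 'k) mpoly"
  where "perm_act \<sigma> f = Poly_Mapping.map_key (Poly_Mapping.map_key \<sigma>) f"

text \<open>
  The elements of the group ring are the formal sums \<open>\<Sum>\<sigma>. s\<^sub>\<sigma> \<sigma>\<close>, given as finitely supported
  families \<open>s\<close> indexed by self-maps of \<open>'x\<close> whose support consists of permutations.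
\<close>

definition sym_group_ring :: "(('x \<Rightarrow> 'x) \<Rightarrow>\<^sub>0 ('x, 'k::comm_ring_1) mpoly) set"
  where "sym_group_ring = {s. Poly_Mapping.keys s \<subseteq> {\<sigma>. bij \<sigma>}}"

definition group_ring_act ::
  "(('x \<Rightarrow> 'x) \<Rightarrow>\<^sub>0 ('x, 'k::comm_ring_1) mpoly) \<Rightarrow> ('x, 'k) mpoly \<Rightarrow> ('x, 'k) mpoly"
  where "group_ring_act s f =
    (\<Sum>\<sigma>\<in>Poly_Mapping.keys s. Poly_Mapping.lookup s \<sigma> * perm_act \<sigma> f)"

definition invariant_ideal :: "('x, 'k::comm_ring_1) mpoly set \<Rightarrow> bool"
  where "invariant_ideal I \<longleftrightarrow>
    0 \<in> I \<and> (\<forall>f\<in>I. \<forall>g\<in>I. f + g \<in> I) \<and> (\<forall>s\<in>sym_group_ring. \<forall>f\<in>I. group_ring_act s f \<in> I)"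

definition sym_generates :: "('x, 'k::comm_ring_1) mpoly set \<Rightarrow> ('x, 'k) mpoly set \<Rightarrow> bool"
  where "sym_generates P I \<longleftrightarrow>
    invariant_ideal I \<and> P \<subseteq> I \<and> (\<forall>J. invariant_ideal J \<longrightarrow> P \<subseteq> J \<longrightarrow> I \<subseteq> J)"

lemma bij_map_key:
  assumes "bij \<sigma>"
  shows "bij (Poly_Mapping.map_key \<sigma> :: ('x \<Rightarrow>\<^sub>0 'b::zero) \<Rightarrow> 'x \<Rightarrow>\<^sub>0 'b)"
proof (rule o_bij)
  have i: "inj \<sigma>" "inj (inv \<sigma>)"
    using assms by (simp_all add: bij_is_inj bij_imp_bij_inv)
  have "\<sigma> \<circ> inv \<sigma> = (\<lambda>x. x)" "inv \<sigma> \<circ> \<sigma> = (\<lambda>x. x)"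
    using assms by (auto simp: fun_eq_iff bij_is_inj bij_is_surj surj_f_inv_f)
  then have "Poly_Mapping.map_key (inv \<sigma>) (Poly_Mapping.map_key \<sigma> m) = m"
    "Poly_Mapping.map_key \<sigma> (Poly_Mapping.map_key (inv \<sigma>) m) = m" for m :: "'x \<Rightarrow>\<^sub>0 'b"
    using map_key_compose[OF i(2,1), of m] map_key_compose[OF i, of m] map_key_id[of m]
    by simp_all
  then show "Poly_Mapping.map_key (inv \<sigma>) \<circ> Poly_Mapping.map_key \<sigma> = (id :: ('x \<Rightarrow>\<^sub>0 'b) \<Rightarrow> ('x \<Rightarrow>\<^sub>0 'b))"
    "Poly_Mapping.map_key \<sigma> \<circ> Poly_Mapping.map_key (inv \<sigma>) = (id :: ('x \<Rightarrow>\<^sub>0 'b) \<Rightarrow> ('x \<Rightarrow>\<^sub>0 'b))"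
    by (simp_all add: fun_eq_iff)
qed

lemma lookup_perm_act:
  assumes "bij \<sigma>"
  shows "Poly_Mapping.lookup (perm_act \<sigma> f) m =
    Poly_Mapping.lookup f (Poly_Mapping.map_key \<sigma> m)"
  using bij_is_inj[OF bij_map_key[OF assms, where 'b = nat]]
  by (simp add: perm_act_def map_key.rep_eq)

lemma perm_act_id: "perm_act id f = f"
proof (rule poly_mapping_eqI)
  show "Poly_Mapping.lookup (perm_act id f) m = Poly_Mapping.lookup f m" for m
    unfolding lookup_perm_act[OF bij_id] by (simp add: id_def map_key_id)
qed

lemma perm_act_add:
  assumes "bij \<sigma>"
  shows "perm_act \<sigma> (f + g) = perm_act \<sigma> f + perm_act \<sigma> g"
  by (rule poly_mapping_eqI) (simp add: lookup_perm_act assms lookup_add)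

lemma perm_act_single:
  assumes "bij \<sigma>"
  shows "perm_act \<sigma> (Poly_Mapping.single m c) =
    Poly_Mapping.single (Poly_Mapping.map_key (inv \<sigma>) m) c"
proof (rule poly_mapping_eqI)
  fix k
  have i: "inj \<sigma>" "inj (inv \<sigma>)"
    using assms by (simp_all add: bij_is_inj bij_imp_bij_inv)
  have "inv \<sigma> \<circ> \<sigma> = (\<lambda>x. x)" "\<sigma> \<circ> inv \<sigma> = (\<lambda>x. x)"
    using assms by (auto simp: fun_eq_iff bij_is_inj bij_is_surj surj_f_inv_f)
  then have "m = Poly_Mapping.map_key \<sigma> k \<longleftrightarrow> Poly_Mapping.map_key (inv \<sigma>) m = k"
    using i by (metis map_key_compose map_key_id)
  then show "Poly_Mapping.lookup (perm_act \<sigma> (Poly_Mapping.single m c)) k =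
      Poly_Mapping.lookup (Poly_Mapping.single (Poly_Mapping.map_key (inv \<sigma>) m) c) k"
    by (simp add: lookup_perm_act assms lookup_single)
qed

lemma perm_act_mult:
  fixes f g :: "('x, 'k::comm_ring_1) mpoly"
  assumes "bij \<sigma>"
  shows "perm_act \<sigma> (f * g) = perm_act \<sigma> f * perm_act \<sigma> g"
proof -
  have inj: "inj (inv \<sigma>)"
    using assms by (simp add: bij_is_inj bij_imp_bij_inv)
  have upd: "Poly_Mapping.update a b h = Poly_Mapping.single a b + h"
    if "a \<notin> Poly_Mapping.keys h" for a and b :: "'k" and h :: "('x, 'k) mpoly"
    using that
    by (intro poly_mapping_eqI)
      (auto simp: lookup_update lookup_add lookup_single in_keys_iff when_def)
  have z: "perm_act \<sigma> (0 :: ('x, 'k) mpoly) = 0"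
    by (rule poly_mapping_eqI) (simp add: lookup_perm_act assms)
  have s: "perm_act \<sigma> (Poly_Mapping.single m c * g) =
      perm_act \<sigma> (Poly_Mapping.single m c) * perm_act \<sigma> g" for m c
  proof (induction g rule: update_induct)
    case const
    then show ?case by (simp add: z)
  next
    case (update h a b)
    then show ?case
      by (simp add: upd perm_act_add assms distrib_left mult_single perm_act_single
          map_key_plus inj)
  qed
  show ?thesis
  proof (induction f rule: update_induct)
    case const
    then show ?case by (simp add: z)
  next
    case (update h a b)
    then show ?case
      by (simp add: upd perm_act_add assms distrib_right s)
  qed
qed

lemma perm_act_Const:
  assumes "bij \<sigma>"
  shows "perm_act \<sigma> (Const c) = Const c"
  using assms by (simp add: Const_def perm_act_single bij_is_inj bij_imp_bij_inv)

lemma perm_act_Var: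
  assumes "bij \<sigma>"
  shows "perm_act \<sigma> (Var x) = Var (\<sigma> x)"
proof -
  have "inj (inv \<sigma>)" "inv \<sigma> (\<sigma> x) = x"
    using assms by (simp_all add: bij_is_inj bij_imp_bij_inv)
  then show ?thesis
    using map_key_single[of "inv \<sigma>" "\<sigma> x" "1::nat"]
    by (simp add: Var_def perm_act_single assms)
qed

lemma invariant_ideal_iff:
  "invariant_ideal I \<longleftrightarrow>
    0 \<in> I \<and> (\<forall>f\<in>I. \<forall>g\<in>I. f + g \<in> I) \<and> (\<forall>r. \<forall>f\<in>I. r * f \<in> I) \<and>
    (\<forall>\<sigma>. bij \<sigma> \<longrightarrow> perm_act \<sigma> ` I \<subseteq> I)"
  (is "_ \<longleftrightarrow> ?R")
proof
  assume I: "invariant_ideal I"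
  have single: "r * perm_act \<sigma> f \<in> I" if "bij \<sigma>" "f \<in> I" for r \<sigma> f
  proof -
    have "group_ring_act (Poly_Mapping.single \<sigma> r) f \<in> I"
      using I that by (auto simp: invariant_ideal_def sym_group_ring_def)
    moreover have "group_ring_act (Poly_Mapping.single \<sigma> r) f = r * perm_act \<sigma> f"
      by (cases "r = 0") (simp_all add: group_ring_act_def)
    ultimately show ?thesis by simp
  qed
  show ?R
    using I single[where r = 1] single[where \<sigma> = id] by (auto simp: invariant_ideal_def perm_act_id)
next
  assume R: ?R
  have "(\<Sum>\<sigma>\<in>A. h \<sigma>) \<in> I" if "finite A" "\<And>\<sigma>. \<sigma> \<in> A \<Longrightarrow> h \<sigma> \<in> I"
    for A and h :: "('a \<Rightarrow> 'a) \<Rightarrow> _"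
    using that R by (induction A rule: finite_induct) auto
  then show "invariant_ideal I"
    using R unfolding invariant_ideal_def sym_group_ring_def group_ring_act_def
    by (simp add: image_subset_iff subset_eq)
qed

lemma perm_act_compose:
  assumes "bij \<sigma>" "bij \<tau>"
  shows "perm_act \<sigma> (perm_act \<tau> f) = perm_act (\<sigma> \<circ> \<tau>) f"
  using assms
  by (intro poly_mapping_eqI) (simp add: lookup_perm_act bij_comp map_key_compose bij_is_inj)

lemma module_mult: "module ((*) :: 'a::comm_ring_1 \<Rightarrow> 'a \<Rightarrow> 'a)"
  by unfold_locales (simp_all add: algebra_simps)

lemma sym_generates_iff:
  "sym_generates P I \<longleftrightarrow> I = module.span (*) {perm_act \<sigma> p |\<sigma> p. bij \<sigma> \<and> p \<in> P}"
  (is "_ \<longleftrightarrow> I = ?S")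
proof -
  interpret R: module "(*) :: ('a, 'b) mpoly \<Rightarrow> _" by (rule module_mult)
  let ?G = "{perm_act \<sigma> p |\<sigma> p. bij \<sigma> \<and> p \<in> P}"
  have perm_in: "perm_act \<sigma> f \<in> ?S" if "bij \<sigma>" "f \<in> ?S" for \<sigma> f
    using that(2)
  proof (induction rule: R.span_induct_alt)
    case base
    have "perm_act \<sigma> 0 = (0 :: ('a, 'b) mpoly)"
      by (rule poly_mapping_eqI) (simp add: lookup_perm_act that)
    then show ?case by (simp add: R.span_zero)
  next
    case (step c x y)
    then obtain \<tau> p where "x = perm_act \<tau> p" "bij \<tau>" "p \<in> P" by blast
    then have "perm_act \<sigma> x \<in> ?G"
      using that(1) by (auto simp: perm_act_compose intro: bij_comp)
    then show ?case
      using step that(1)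
      by (simp add: perm_act_add perm_act_mult R.span_add R.span_scale R.span_base)
  qed
  have inv: "invariant_ideal ?S"
    unfolding invariant_ideal_iff
    by (auto simp: R.span_zero R.span_add R.span_scale perm_in)
  have "P \<subseteq> ?G"
    using perm_act_id by (metis (mono_tags, lifting) bij_id mem_Collect_eq subsetI)
  then have sub: "P \<subseteq> ?S"
    using R.span_superset by blast
  have least: "?S \<subseteq> J" if "invariant_ideal J" "P \<subseteq> J" for J
    using that
    by (intro R.span_minimal R.subspaceI) (auto simp: invariant_ideal_iff image_subset_iff subset_eq)
  show ?thesis
    using inv sub least unfolding sym_generates_def by blast
qed

end

theory Submission
  imports Defs "HOL-Computational_Algebra.Polynomial"
begin

text \<open>
  The invariant ideal is generated by the \<open>n\<close> monomials \<open>x\<^sup>n\<^sup>-\<^sup>k y\<^sup>n\<^sup>+\<^sup>k\<close> with \<open>k < n\<close>, for two fixed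
  distinct indeterminates \<open>x\<close> and \<open>y\<close>. They all have the same degree \<open>d = 2n\<close>, and no two of them
  lie in one orbit of the symmetric group, since their largest exponents differ.

  That fewer generators cannot suffice is a dimension count over \<open>K\<close>. Let \<open>\<Lambda> f\<close> add up the
  coefficients of \<open>f\<close> at the monomials of degree \<open>d\<close>, separately for each value of the largest
  exponent; the result is recorded as the univariate polynomial
  \<open>\<Sum>\<^bsub>deg m = d\<^esub> f\<^sub>m t\<^bsup>max m\<^esup>\<close>. Permuting the indeterminates does not change \<open>\<Lambda> f\<close>. If \<open>f\<close> has no
  terms of degree below \<open>d\<close>, then only the constant term \<open>r\<^sub>0\<close> of a multiplier \<open>r\<close> reaches degree
  \<open>d\<close>, so \<open>\<Lambda> (r f) = r\<^sub>0 \<Lambda> f\<close>. On polynomials of order at least \<open>d\<close> the module structure over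
  the group ring therefore collapses under \<open>\<Lambda>\<close> to the vector space structure over \<open>K\<close>: whenever
  \<open>Q\<close> generates \<open>I\<close>, the vectors \<open>\<Lambda> q\<close> with \<open>q \<in> Q\<close> span \<open>\<Lambda> I\<close>
  (\<open>coeff_sum_in_span_generators\<close>). The chosen generators have the images \<open>t\<^sup>n\<^sup>+\<^sup>k\<close>, which are linearly
  independent, so every generating set has at least \<open>n\<close> elements.
\<close>

section \<open>Invariants of monomials under permutations\<close>

definition total_degree :: "('x \<Rightarrow>\<^sub>0 nat) \<Rightarrow> nat"
  where "total_degree m = (\<Sum>x\<in>Poly_Mapping.keys m. Poly_Mapping.lookup m x)"

lemma total_degree_single [simp]: "total_degree (Poly_Mapping.single x k) = k"
  by (simp add: total_degree_def)

lemma total_degree_add: "total_degree (a + b) = total_degree a + total_degree b"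
proof -
  let ?A = "Poly_Mapping.keys a \<union> Poly_Mapping.keys b"
  have on_A: "total_degree m = (\<Sum>x\<in>?A. Poly_Mapping.lookup m x)"
    if "Poly_Mapping.keys m \<subseteq> ?A" for m :: "'a \<Rightarrow>\<^sub>0 nat"
    unfolding total_degree_def using that
    by (intro sum.mono_neutral_left) (auto simp: in_keys_iff)
  show ?thesis
    using on_A[of a] on_A[of b] on_A[of "a + b"] keys_add[of a b]
    by (simp add: lookup_add sum.distrib)
qed

lemma total_degree_eq_0_iff: "total_degree m = 0 \<longleftrightarrow> m = 0"
  by (auto simp: total_degree_def in_keys_iff intro: poly_mapping_eqI)

lemma total_degree_map_key:
  assumes "bij \<sigma>"
  shows "total_degree (Poly_Mapping.map_key \<sigma> m) = total_degree m"
proof -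
  have "bij_betw \<sigma> (Poly_Mapping.keys (Poly_Mapping.map_key \<sigma> m)) (Poly_Mapping.keys m)"
    unfolding keys_map_key[OF bij_is_inj[OF assms]] bij_betw_def
    using surj_image_vimage_eq[OF bij_is_surj[OF assms]] inj_on_subset[OF bij_is_inj[OF assms]]
    by blast
  then show ?thesis
    unfolding total_degree_def map_key.rep_eq[OF bij_is_inj[OF assms]] comp_def
    by (rule sum.reindex_bij_betw)
qed

definition max_exponent :: "('x \<Rightarrow>\<^sub>0 nat) \<Rightarrow> nat"
  where "max_exponent m = Max (range (Poly_Mapping.lookup m))"

lemma max_exponent_map_key:
  assumes "bij \<sigma>"
  shows "max_exponent (Poly_Mapping.map_key \<sigma> m) = max_exponent m"
proof -
  have "range (Poly_Mapping.lookup m \<circ> \<sigma>) = range (Poly_Mapping.lookup m)"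
    unfolding image_comp [symmetric] bij_is_surj[OF assms] ..
  then show ?thesis
    by (simp only: max_exponent_def map_key.rep_eq[OF bij_is_inj[OF assms]])
qed

lemma max_exponent_two_variables:
  assumes "x \<noteq> y" "a \<le> b"
  shows "max_exponent (Poly_Mapping.single x a + Poly_Mapping.single y b) = b"
  unfolding max_exponent_def
proof (rule Max_eqI)
  let ?m = "Poly_Mapping.single x a + Poly_Mapping.single y b"
  have "range (Poly_Mapping.lookup ?m) \<subseteq> {..b}"
    using assms by (simp add: image_subset_iff lookup_add lookup_single when_def)
  then show "finite (range (Poly_Mapping.lookup ?m))"
    and "\<And>k. k \<in> range (Poly_Mapping.lookup ?m) \<Longrightarrow> k \<le> b"
    by (auto intro: finite_subset)
  have "Poly_Mapping.lookup ?m y = b"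
    using assms by (simp add: lookup_add lookup_single)
  then show "b \<in> range (Poly_Mapping.lookup ?m)"
    by (metis rangeI)
qed

section \<open>Leading behaviour of products\<close>

definition order_at_least :: "nat \<Rightarrow> ('x, 'k::zero) mpoly \<Rightarrow> bool"
  where "order_at_least d f \<longleftrightarrow> (\<forall>m\<in>Poly_Mapping.keys f. d \<le> total_degree m)"

lemma order_at_least_iff:
  "order_at_least d f \<longleftrightarrow> (\<forall>m. Poly_Mapping.lookup f m \<noteq> 0 \<longrightarrow> d \<le> total_degree m)"
  by (auto simp: order_at_least_def in_keys_iff)

lemma order_at_least_add:
  "order_at_least d f \<Longrightarrow> order_at_least d g \<Longrightarrow> order_at_least d (f + g)"
  using keys_add[of f g] by (auto simp: order_at_least_def)

lemma order_at_least_mult: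
  "order_at_least d r \<Longrightarrow> order_at_least e f \<Longrightarrow> order_at_least (d + e) (r * f)"
  using keys_mult[of r f] by (fastforce simp: order_at_least_def total_degree_add)

lemma order_at_least_perm_act:
  assumes "bij \<sigma>" "order_at_least d f"
  shows "order_at_least d (perm_act \<sigma> f)"
  unfolding order_at_least_iff
proof (intro allI impI)
  fix m assume "Poly_Mapping.lookup (perm_act \<sigma> f) m \<noteq> 0"
  then have "d \<le> total_degree (Poly_Mapping.map_key \<sigma> m)"
    using assms by (simp add: order_at_least_iff lookup_perm_act)
  then show "d \<le> total_degree m"
    by (simp add: total_degree_map_key assms(1))
qed

lemma lookup_Const_mult: "Poly_Mapping.lookup (Const c * f) m = c * Poly_Mapping.lookup f m"
  by (simp add: Const_def mult_map_scale_conv_mult [symmetric] Poly_Mapping.map.rep_eq when_def)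

text \<open>
  Splitting off the constant term of \<open>r\<close> leaves a polynomial of order at least \<open>1\<close>, whose product
  with \<open>f\<close> has order at least \<open>d + 1\<close> and hence no coefficient in degree \<open>d\<close>.
\<close>

lemma lookup_mult_lowest_degree:
  fixes r f :: "('x, 'k::comm_ring_1) mpoly"
  assumes "order_at_least d f" "total_degree m = d"
  shows "Poly_Mapping.lookup (r * f) m = Poly_Mapping.lookup r 0 * Poly_Mapping.lookup f m"
proof -
  define r' where "r' = r - Const (Poly_Mapping.lookup r 0)"
  have "Poly_Mapping.lookup r' 0 = 0"
    by (simp add: r'_def Const_def lookup_minus)
  then have "order_at_least 1 r'"
    by (auto simp: order_at_least_def in_keys_iff Suc_le_eq total_degree_eq_0_iff
        simp flip: neq0_conv)
  then have "order_at_least (1 + d) (r' * f)"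
    using assms(1) by (rule order_at_least_mult)
  then have "Poly_Mapping.lookup (r' * f) m = 0"
    using assms(2) by (force simp: order_at_least_iff)
  moreover have "r * f = Const (Poly_Mapping.lookup r 0) * f + r' * f"
    by (simp add: r'_def algebra_simps)
  ultimately show ?thesis
    by (simp add: lookup_add lookup_Const_mult)
qed

section \<open>Weighted coefficient sums and the lower bound on generators\<close>

text \<open>
  A vector-valued weight on monomials that lives in a single degree \<open>d\<close> and is constant on the orbits
  of the symmetric group. These two properties make its linear extension respect the action of the
  group ring on polynomials of order at least \<open>d\<close>, up to the constant terms of the multipliers.
\<close>

locale invariant_weight = vector_space scale
  for scale :: "'k::field \<Rightarrow> 'v::ab_group_add \<Rightarrow> 'v" (infixr \<open>*s\<close> 75) +
  fixes d :: nat and w :: "('x \<Rightarrow>\<^sub>0 nat) \<Rightarrow> 'v"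
  assumes homogeneous: "w m \<noteq> 0 \<Longrightarrow> total_degree m = d"
    and invariant: "bij \<sigma> \<Longrightarrow> w (Poly_Mapping.map_key \<sigma> m) = w m"
begin

text \<open>This is the \<open>K\<close>-linear extension of \<open>w\<close> from monomials to polynomials.\<close>

definition coeff_sum :: "('x, 'k) mpoly \<Rightarrow> 'v"
  where "coeff_sum f = (\<Sum>m\<in>Poly_Mapping.keys f. Poly_Mapping.lookup f m *s w m)"

lemma coeff_sum_superset:
  assumes "finite A" "Poly_Mapping.keys f \<subseteq> A"
  shows "coeff_sum f = (\<Sum>m\<in>A. Poly_Mapping.lookup f m *s w m)"
  unfolding coeff_sum_def using assms
  by (intro sum.mono_neutral_left) (auto simp: in_keys_iff)

lemma coeff_sum_0 [simp]: "coeff_sum 0 = 0"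
  by (simp add: coeff_sum_def)

lemma coeff_sum_single [simp]: "coeff_sum (Poly_Mapping.single m c) = c *s w m"
  by (simp add: coeff_sum_def)

lemma coeff_sum_add: "coeff_sum (f + g) = coeff_sum f + coeff_sum g"
proof -
  let ?A = "Poly_Mapping.keys f \<union> Poly_Mapping.keys g"
  show ?thesis
    using coeff_sum_superset[of ?A f] coeff_sum_superset[of ?A g]
      coeff_sum_superset[of ?A "f + g"] keys_add[of f g]
    by (simp add: lookup_add scale_left_distrib sum.distrib)
qed

lemma coeff_sum_perm_act:
  assumes "bij \<sigma>"
  shows "coeff_sum (perm_act \<sigma> f) = coeff_sum f"
proof -
  let ?s = "Poly_Mapping.map_key \<sigma> :: ('x \<Rightarrow>\<^sub>0 nat) \<Rightarrow> ('x \<Rightarrow>\<^sub>0 nat)"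
  have s: "bij ?s"
    using assms(1) by (rule bij_map_key)
  have "Poly_Mapping.keys (perm_act \<sigma> f) = ?s -` Poly_Mapping.keys f"
    by (auto simp: in_keys_iff lookup_perm_act assms(1))
  then have "bij_betw ?s (Poly_Mapping.keys (perm_act \<sigma> f)) (Poly_Mapping.keys f)"
    using bij_is_surj[OF s] inj_on_subset[OF bij_is_inj[OF s] subset_UNIV]
    by (simp add: bij_betw_def surj_image_vimage_eq)
  then have "coeff_sum f =
      (\<Sum>m\<in>Poly_Mapping.keys (perm_act \<sigma> f). Poly_Mapping.lookup f (?s m) *s w (?s m))"
    unfolding coeff_sum_def by (rule sum.reindex_bij_betw [symmetric])
  then show ?thesis
    by (simp add: coeff_sum_def lookup_perm_act assms invariant)
qed

lemma coeff_sum_mult: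
  assumes "order_at_least d f"
  shows "coeff_sum (r * f) = Poly_Mapping.lookup r 0 *s coeff_sum f"
proof -
  let ?A = "Poly_Mapping.keys f \<union> Poly_Mapping.keys (r * f)"
  have "Poly_Mapping.lookup (r * f) m *s w m =
      Poly_Mapping.lookup r 0 *s (Poly_Mapping.lookup f m *s w m)" for m
    by (cases "w m = 0") (simp_all add: lookup_mult_lowest_degree[OF assms homogeneous])
  then show ?thesis
    using coeff_sum_superset[of ?A f] coeff_sum_superset[of ?A "r * f"]
    \<comment> \<open>the nested scaling has to stay as it is for the termwise equation to match\<close>
    by (simp add: scale_sum_right del: scale_scale scale_cancel_right)
qed

text \<open>
  Multiplying by \<open>r\<close> scales the coefficient sum by a constant and a permutation leaves it alone, so
  any \<open>K\<close>-subspace of values pulls back to an invariant ideal. This turns the minimality of a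
  generated ideal into a statement of linear algebra.
\<close>

lemma invariant_ideal_coeff_sum_in_subspace:
  assumes "subspace S"
  shows "invariant_ideal {f. order_at_least d f \<and> coeff_sum f \<in> S}"
  unfolding invariant_ideal_iff
proof (intro conjI)
  show "0 \<in> {f. order_at_least d f \<and> coeff_sum f \<in> S}"
    using assms(1) by (simp add: order_at_least_def subspace_0)
next
  have "order_at_least d (r * f)" if "order_at_least d f" for r f :: "('x, 'k) mpoly"
    using order_at_least_mult[of 0 r d f] that by (simp add: order_at_least_def)
  then show "\<forall>r. \<forall>f\<in>{f. order_at_least d f \<and> coeff_sum f \<in> S}.
      r * f \<in> {f. order_at_least d f \<and> coeff_sum f \<in> S}"
    using assms by (auto simp: coeff_sum_mult subspace_scale)
qed (simp_all add: assms order_at_least_add coeff_sum_add subspace_add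
    image_subset_iff order_at_least_perm_act coeff_sum_perm_act)

text \<open>
  The polynomials of order at least \<open>d\<close> whose coefficient sum lies in the span of those of \<open>Q\<close> form
  an invariant ideal containing \<open>Q\<close>, hence containing everything that \<open>Q\<close> generates.
\<close>

lemma coeff_sum_in_span_generators:
  assumes "sym_generates Q I" "\<And>q. q \<in> Q \<Longrightarrow> order_at_least d q"
    and "f \<in> I"
  shows "order_at_least d f" "coeff_sum f \<in> span (coeff_sum ` Q)"
proof -
  let ?J = "{f. order_at_least d f \<and> coeff_sum f \<in> span (coeff_sum ` Q)}"
  have "invariant_ideal ?J"
    using subspace_span by (rule invariant_ideal_coeff_sum_in_subspace)
  moreover have "Q \<subseteq> ?J"
    using assms(2) by (auto intro: span_base)
  ultimately have "f \<in> ?J"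
    using assms(1,3) by (auto simp: sym_generates_def)
  then show "order_at_least d f" "coeff_sum f \<in> span (coeff_sum ` Q)"
    by simp_all
qed

text \<open>
  The set \<open>Q\<close> is arbitrary, but its elements lie in the ideal generated by \<open>P\<close> and therefore inherit
  the order bound from \<open>P\<close>. So \<open>coeff_sum\<close> sees \<open>Q\<close> as a spanning set for the images of \<open>P\<close>.
\<close>

lemma card_generators_ge:
  assumes P: "sym_generates P I" "\<And>p. p \<in> P \<Longrightarrow> order_at_least d p"
    and Q: "sym_generates Q I" "finite Q"
    and indep: "independent (coeff_sum ` P)"
  shows "card (coeff_sum ` P) \<le> card Q"
proof -
  have PQ: "P \<subseteq> I" "Q \<subseteq> I"
    using P(1) Q(1) by (simp_all add: sym_generates_def)
  have "order_at_least d q" if "q \<in> Q" for q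
    using coeff_sum_in_span_generators(1)[OF P] that PQ(2) by blast
  then have "coeff_sum ` P \<subseteq> span (coeff_sum ` Q)"
    using coeff_sum_in_span_generators(2)[OF Q(1)] PQ(1) by blast
  then have "card (coeff_sum ` P) \<le> card (coeff_sum ` Q)"
    using independent_span_bound indep Q(2) by blast
  also have "\<dots> \<le> card Q"
    using Q(2) by (rule card_image_le)
  finally show ?thesis .
qed

end

section \<open>Monomials of equal degree and different shape\<close>

lemma vector_space_smult: "vector_space (smult :: 'k::field \<Rightarrow> 'k poly \<Rightarrow> 'k poly)"
  by unfold_locales (simp_all add: smult_add_right smult_add_left)

lemma independent_monom:
  "\<not> module.dependent smult ((\<lambda>i. monom (1 :: 'k::field) i) ` A)"
proof -
  interpret vector_space "smult :: 'k \<Rightarrow> 'k poly \<Rightarrow> 'k poly"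
    by (rule vector_space_smult)
  show ?thesis
    unfolding independent_explicit_module
  proof (intro allI impI)
    fix S u and v :: "'k poly"
    assume S: "finite S" "S \<subseteq> (\<lambda>i. monom 1 i) ` A" "(\<Sum>v\<in>S. smult (u v) v) = 0" "v \<in> S"
    then obtain i where i: "v = monom 1 i"
      by blast
    have "coeff (smult (u p) p) i = (if p = v then u v else 0)" if "p \<in> S" for p
      using that S(2) by (auto simp: i split: if_splits)
    then have "coeff (\<Sum>p\<in>S. smult (u p) p) i = u v"
      using S(1,4) by (simp add: Polynomial.coeff_sum sum.delta)
    then show "u v = 0"
      using S(3) by simp
  qed
qed

theorem theorem1:
  fixes n :: nat
  assumes "infinite (UNIV :: 'x set)" and "n > 0"
  shows "\<exists>I :: ('x, 'k::field) mpoly set. invariant_ideal I \<and>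
    (\<exists>P. finite P \<and> card P = n \<and> sym_generates P I) \<and>
    \<not> (\<exists>Q. finite Q \<and> card Q < n \<and> sym_generates Q I)"
proof -
  obtain x y :: 'x where "x \<noteq> y"
    using assms(1) by (metis (full_types) UNIV_eq_I finite.emptyI finite_insert insertI1)
  define mono where "mono k = Poly_Mapping.single x (n - k) + Poly_Mapping.single y (n + k)" for k
  define P :: "('x, 'k) mpoly set" where "P = (\<lambda>k. Poly_Mapping.single (mono k) 1) ` {..<n}"
  \<comment> \<open>the power of the variable records the largest exponent, which tells the orbits of the
    generators apart\<close>
  define w :: "('x \<Rightarrow>\<^sub>0 nat) \<Rightarrow> 'k poly"
    where "w m = (if total_degree m = 2 * n then monom 1 (max_exponent m) else 0)" for m
  interpret W: invariant_weight smult "2 * n" w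
    by (intro invariant_weight.intro vector_space_smult invariant_weight_axioms.intro)
      (simp_all add: w_def total_degree_map_key max_exponent_map_key split: if_splits)
  have degree: "total_degree (mono k) = 2 * n" if "k < n" for k
    using that by (simp add: mono_def total_degree_add)
  have w_mono: "w (mono k) = monom 1 (n + k)" if "k < n" for k
    using degree[OF that] max_exponent_two_variables[OF \<open>x \<noteq> y\<close>, of "n - k" "n + k"]
    by (simp add: w_def mono_def)
  have image: "W.coeff_sum ` P = (\<lambda>i. monom 1 i) ` (\<lambda>k. n + k) ` {..<n}"
    by (simp add: P_def image_image w_mono cong: image_cong_simp)
  have card_image: "card (W.coeff_sum ` P) = n"
    unfolding image by (simp add: card_image inj_on_def image_image monom_eq_iff')
  \<comment> \<open>the generators are distinct because their \<open>n\<close> images are\<close>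
  have "finite P" "card P \<le> n"
    using card_image_le[of "{..<n}" "\<lambda>k. Poly_Mapping.single (mono k) (1::'k)"]
    by (simp_all add: P_def)
  moreover have "n \<le> card P"
    using card_image_le[OF \<open>finite P\<close>, of "W.coeff_sum"] card_image by simp
  ultimately have P: "finite P" "card P = n"
    by simp_all
  obtain I where I: "sym_generates P I"
    using sym_generates_iff by blast
  have "n \<le> card Q" if "sym_generates Q I" "finite Q" for Q
    unfolding card_image [symmetric] using I _ that
  proof (rule W.card_generators_ge)
    show "order_at_least (2 * n) p" if "p \<in> P" for p
      using that by (auto simp: P_def order_at_least_def degree)
    show "W.independent (W.coeff_sum ` P)"
      unfolding image by (rule independent_monom)
  qed
  then have "\<not> (\<exists>Q. finite Q \<and> card Q < n \<and> sym_generates Q I)"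
    by (meson leD)
  then show ?thesis
    using I P by (auto simp: sym_generates_def)
qed

end
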